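(* There is an infinite family of graphs $G$ of boxicity $2$ and bandwidth $O(1)$ such that, for any two interval graphs $I_1,I_2$ on vertex set $V(G)$ with $E(G)=E(I_1)\cap E(I_2)$, at least one of $I_1,I_2$ has treewidth $\Omega(|V(G)|)$.
   Context: A graph has boxicity at most $d$ iff it is the intersection (same vertex set, intersection of edge sets) of $d$ interval graphs; the boxicity is the least such $d$. An interval graph is the intersection graph of a finite family of closed real intervals. The bandwidth of $G$ is the least $k$ such that the vertices of $G$ can be assigned distinct integers $\ell(v)$ with $|\ell(u)-\ell(v)|\le k$ for every edge $uv$. The treewidth of $G$ is the minimum, over all chordal supergraphs $H$ of $G$ on the same vertex set, of the clique number of $H$ minus one. *)

theory Defs
  imports Complex_Main "Graph_Theory.Graph_Theory"
begin

text \<open>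
  Finite simple graphs are the pair graphs of \<open>Graph_Theory\<close>: an undirected edge \<open>uv\<close> is
  represented by the two arcs \<open>(u, v)\<close> and \<open>(v, u)\<close>.
\<close>

definition interval_graph :: "'a pair_pre_digraph \<Rightarrow> bool" where
  "interval_graph G \<longleftrightarrow> pair_graph G \<and>
     (\<exists>l r :: 'a \<Rightarrow> real. (\<forall>v \<in> pverts G. l v \<le> r v) \<and>
        parcs G = {(u, v). u \<in> pverts G \<and> v \<in> pverts G \<and> u \<noteq> v \<and>
                           {l u..r u} \<inter> {l v..r v} \<noteq> {}})"

text \<open>The intersection of zero interval graphs on a vertex set is the complete graph on it.\<close>

definition boxicity_at_most :: "'a pair_pre_digraph \<Rightarrow> nat \<Rightarrow> bool" where
  "boxicity_at_most G d \<longleftrightarrow>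
     (\<exists>I :: nat \<Rightarrow> 'a pair_pre_digraph.
        (\<forall>i<d. interval_graph (I i) \<and> pverts (I i) = pverts G) \<and>
        parcs G = {(u, v). u \<in> pverts G \<and> v \<in> pverts G \<and> u \<noteq> v \<and>
                           (\<forall>i<d. (u, v) \<in> parcs (I i))})"

definition boxicity :: "'a pair_pre_digraph \<Rightarrow> nat" where
  "boxicity G = (LEAST d. boxicity_at_most G d)"

definition bandwidth :: "'a pair_pre_digraph \<Rightarrow> nat" where
  "bandwidth G = (LEAST k. \<exists>l :: 'a \<Rightarrow> int. inj_on l (pverts G) \<and>
     (\<forall>(u, v) \<in> parcs G. \<bar>l u - l v\<bar> \<le> int k))"

definition clique :: "'a pair_pre_digraph \<Rightarrow> 'a set \<Rightarrow> bool" where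
  "clique G S \<longleftrightarrow> S \<subseteq> pverts G \<and> (\<forall>u \<in> S. \<forall>v \<in> S. u \<noteq> v \<longrightarrow> (u, v) \<in> parcs G)"

definition clique_number :: "'a pair_pre_digraph \<Rightarrow> nat" where
  "clique_number G = Max (card ` {S. clique G S})"

text \<open>
  A cycle \<open>p\<close> is a list of arcs. A chord is an edge between two vertices of the cycle
  that is traversed by \<open>p\<close> in neither direction.
\<close>

definition chordal :: "'a pair_pre_digraph \<Rightarrow> bool" where
  "chordal G \<longleftrightarrow> pair_graph G \<and>
     (\<forall>p. pre_digraph.cycle (with_proj G) p \<and> 4 \<le> length p \<longrightarrow>
        (\<exists>u \<in> fst ` set p. \<exists>v \<in> fst ` set p.
           (u, v) \<in> parcs G \<and> (u, v) \<notin> set p \<and> (v, u) \<notin> set p))"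

text \<open>Integer-valued, so that the graph without vertices has treewidth \<open>-1\<close>.\<close>

definition treewidth :: "'a pair_pre_digraph \<Rightarrow> int" where
  "treewidth G = int (LEAST w. \<exists>H. chordal H \<and> pverts H = pverts G \<and> parcs G \<subseteq> parcs H \<and>
     clique_number H = w) - 1"

end

theory Submission
  imports Defs
begin

text \<open>
  Take pairs \<open>P\<^sub>0, \<dots>, P\<^sub>n\<^sub>-\<^sub>1\<close> of vertices \<open>(i, s)\<close>, join \<open>P\<^sub>i\<close> completely to \<open>P\<^sub>i\<^sub>+\<^sub>1\<close>, and join
  \<open>(i, s)\<close> to \<open>(i + 2, s)\<close>. Drawing the pairs alternately as the vertical and the horizontal sides
  of concentric rings shows boxicity at most 2.

  In an arbitrary representation by boxes, an induced 4-cycle has one diagonal separated in exactly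
  the \<open>x\<close>-direction and the other one in exactly the \<open>y\<close>-direction. Hence the pairs are separated
  alternately in the two directions, as are \<open>(i, s)\<close> and \<open>(i + 2, \<not> s)\<close>. Let \<open>X\<^sub>i\<close> be the gap
  between the two members of \<open>P\<^sub>i\<close>. If \<open>X\<^sub>i\<^sub>+\<^sub>2\<close> is not contained in \<open>X\<^sub>i\<close>, then some member of \<open>P\<^sub>i\<close>
  meets \<open>X\<^sub>i\<^sub>+\<^sub>2\<close>, hence meets all of \<open>P\<^sub>i\<^sub>+\<^sub>3\<close> in that direction, hence is separated from \<open>P\<^sub>i\<^sub>+\<^sub>3\<close> in the
  other one, which forces \<open>X\<^sub>i\<^sub>+\<^sub>1\<close> strictly inside \<open>X\<^sub>i\<^sub>+\<^sub>3\<close>. So the gaps are nested decreasingly up to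
  some index and increasingly afterwards. As the members of \<open>P\<^sub>i\<^sub>+\<^sub>1\<close> span \<open>X\<^sub>i\<close>, a nested sequence of
  gaps gives a clique in one of the two interval graphs, and treewidth is at least the clique
  number minus one.
\<close>

section \<open>Treewidth and cliques\<close>

lemma pcas_pawalk_verts:
  assumes "pcas u p v"
  shows "pawalk_verts u p = u # map snd p"
  using assms by (induction p arbitrary: u) auto

lemma pcas_last:
  assumes "pcas u p v" "p \<noteq> []"
  shows "snd (last p) = v"
  using assms by (induction p arbitrary: u) auto

definition complete_pair_graph :: "'a set \<Rightarrow> 'a pair_pre_digraph" where
  "complete_pair_graph V = \<lparr>pverts = V, parcs = {(u, v). u \<in> V \<and> v \<in> V \<and> u \<noteq> v}\<rparr>"

lemma pair_graphI:
  assumes "finite (pverts G)"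
    and "\<And>u v. (u, v) \<in> parcs G \<Longrightarrow> u \<in> pverts G \<and> v \<in> pverts G \<and> u \<noteq> v \<and> (v, u) \<in> parcs G"
  shows "pair_graph G"
proof -
  have "parcs G \<subseteq> pverts G \<times> pverts G" using assms(2) by auto
  then have "finite (parcs G)" using assms(1) finite_subset by blast
  then show ?thesis
    using assms by unfold_locales (auto simp: symmetric_def intro!: symI)
qed

text \<open>Guarantees that every finite graph has a chordal supergraph, so that the
  \<open>LEAST\<close> in \<open>treewidth\<close> is attained.\<close>

lemma chordal_complete_pair_graph:
  assumes "finite V"
  shows "chordal (complete_pair_graph V)"
  unfolding chordal_def
proof (intro conjI allI impI)
  let ?G = "complete_pair_graph V"
  show "pair_graph ?G"
    by (rule pair_graphI) (use assms in \<open>auto simp: complete_pair_graph_def\<close>)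
  fix p assume p: "pre_digraph.cycle (with_proj ?G) p \<and> 4 \<le> length p"
  obtain e0 e1 e2 e3 q where q: "p = e0 # e1 # e2 # e3 # q"
    using p by (auto simp: numeral_eq_Suc Suc_le_length_iff)
  obtain w where w: "pcas w p w" "distinct (tl (pawalk_verts w p))" and arcs: "set p \<subseteq> parcs ?G"
    using p by (auto simp: pre_digraph.cycle_def pre_digraph.awalk_def cas_with_proj_eq
        awalk_verts_with_proj_eq)
  have dist: "distinct (map snd p)"
    using w pcas_pawalk_verts by fastforce
  have inj: "x = y" if "x \<in> set p" "y \<in> set p" "snd x = snd y" for x y
    using dist that by (auto simp: distinct_map inj_on_def)
  have ends: "fst e0 = snd (last (e3 # q))" "fst e1 = snd e0" "fst e2 = snd e1" "fst e3 = snd e2"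
    using w(1) pcas_last[OF w(1)] q by auto
  have last: "snd (last (e3 # q)) \<in> snd ` set (e3 # q)"
    by (metis last_in_set list.distinct(1) imageI)
  have neq: "snd e0 \<noteq> snd e1" "snd e0 \<noteq> snd e2" "snd e2 \<notin> snd ` set (e3 # q)"
    using dist q by auto
  \<comment> \<open>These two vertices are two steps apart on the cycle. Heads of arcs are distinct,
    so an arc of \<open>p\<close> between them would have to be \<open>e2\<close> or
    \<open>e0\<close>, and both choices repeat a vertex.\<close>
  have "(fst e1, fst e3) \<notin> set p"
    using inj[of "(fst e1, fst e3)" e2] ends neq q by (auto simp: prod_eq_iff)
  moreover have "(fst e3, fst e1) \<notin> set p"
  proof
    assume "(fst e3, fst e1) \<in> set p"
    then have "(fst e3, fst e1) = e0" using inj[of "(fst e3, fst e1)" e0] ends q by simp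
    then have "fst e3 = fst e0" by (metis fst_conv)
    then show False using ends neq(3) last by metis
  qed
  moreover have "(fst e1, fst e3) \<in> parcs ?G"
    using arcs ends neq q by (auto simp: complete_pair_graph_def)
  ultimately show "\<exists>u\<in>fst ` set p. \<exists>v\<in>fst ` set p.
      (u, v) \<in> parcs ?G \<and> (u, v) \<notin> set p \<and> (v, u) \<notin> set p"
    using q by (intro bexI[of _ "fst e1"] bexI[of _ "fst e3"]) auto
qed

text \<open>A clique survives in every supergraph, in particular in a chordal one attaining the
  minimum.\<close>

lemma treewidth_ge_clique:
  assumes "pair_graph G" and "clique G S"
  shows "int (card S) - 1 \<le> treewidth G"
proof -
  interpret pair_graph G by fact
  let ?Q = "\<lambda>w. \<exists>H. chordal H \<and> pverts H = pverts G \<and> parcs G \<subseteq> parcs H \<and> clique_number H = w"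
  have "?Q (clique_number (complete_pair_graph (pverts G)))"
    using chordal_complete_pair_graph[OF pair_finite_verts] arc_fst_in_verts arc_snd_in_verts
      pair_no_loops
    by (intro exI[of _ "complete_pair_graph (pverts G)"]) (force simp: complete_pair_graph_def)
  then have "?Q (LEAST w. ?Q w)" by (rule LeastI)
  then obtain H where H: "pverts H = pverts G" "parcs G \<subseteq> parcs H"
    and w: "clique_number H = (LEAST w. ?Q w)" by blast
  have "clique H S" using assms(2) H by (auto simp: clique_def)
  moreover have "finite {S. clique H S}"
    by (rule finite_subset[of _ "Pow (pverts G)"]) (auto simp: clique_def H pair_finite_verts)
  ultimately have "card S \<le> clique_number H"
    unfolding clique_number_def by (intro Max_ge) auto
  then show ?thesis unfolding treewidth_def w by simp
qed

section \<open>Interval representations\<close>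

definition overlap :: "('a \<Rightarrow> real) \<Rightarrow> ('a \<Rightarrow> real) \<Rightarrow> 'a \<Rightarrow> 'a \<Rightarrow> bool" where
  "overlap l r u v \<longleftrightarrow> l u \<le> r v \<and> l v \<le> r u"

lemma overlap_sym: "overlap l r u v \<longleftrightarrow> overlap l r v u"
  by (auto simp: overlap_def)

lemma overlap_iff_Int_nonempty:
  assumes "l u \<le> r u" "l v \<le> r v"
  shows "overlap l r u v \<longleftrightarrow> {l u..r u} \<inter> {l v..r v} \<noteq> {}"
  using assms by (auto simp: overlap_def)

text \<open>An induced 4-cycle is not an interval graph: if \<open>a\<close> and \<open>b\<close>
  are disjoint, then \<open>c\<close> and \<open>d\<close> both cover the gap between them.\<close>

lemma overlap_diagonal:
  assumes "overlap l r a c" "overlap l r a d" "overlap l r b c" "overlap l r b d"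
  shows "overlap l r a b \<or> overlap l r c d"
  using assms by (auto simp: overlap_def)

text \<open>The interval of \<open>x\<close> covers the gap between \<open>a\<close> and
  \<open>a'\<close>. As \<open>b\<close> reaches \<open>a\<close> but misses \<open>x\<close>, it
  lies to the left of \<open>x\<close>; likewise \<open>b'\<close> lies to the right.\<close>

lemma overlap_strictly_between:
  assumes "overlap l r x a" "overlap l r x a'" "\<not> overlap l r x b" "\<not> overlap l r x b'"
    and "overlap l r a b" "overlap l r a' b'" "r a < l a'"
  shows "min (r b) (r b') < min (r a) (r a') \<and> max (l a) (l a') < max (l b) (l b')"
proof -
  have "l x \<le> r a" "l x \<le> r a'" "l a \<le> r x" "l a' \<le> r x" "l b \<le> r a" "l a' \<le> r b'"
    using assms by (auto simp: overlap_def)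
  moreover from this have "r b < l x" "r x < l b'"
    using assms(3,4,7) unfolding overlap_def by linarith+
  ultimately show ?thesis by linarith
qed

definition interval_pair_graph :: "'a set \<Rightarrow> ('a \<Rightarrow> real) \<Rightarrow> ('a \<Rightarrow> real) \<Rightarrow> 'a pair_pre_digraph" where
  "interval_pair_graph V l r =
     \<lparr>pverts = V, parcs = {(u, v). u \<in> V \<and> v \<in> V \<and> u \<noteq> v \<and> overlap l r u v}\<rparr>"

lemma interval_graph_interval_pair_graph:
  assumes "finite V" "\<And>v. v \<in> V \<Longrightarrow> l v \<le> r v"
  shows "interval_graph (interval_pair_graph V l r)"
  unfolding interval_graph_def
proof (intro conjI exI)
  show "pair_graph (interval_pair_graph V l r)"
    by (rule pair_graphI) (use assms in \<open>auto simp: interval_pair_graph_def overlap_def\<close>)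
  show "\<forall>v\<in>pverts (interval_pair_graph V l r). l v \<le> r v"
    using assms by (simp add: interval_pair_graph_def)
  show "parcs (interval_pair_graph V l r) =
    {(u, v). u \<in> pverts (interval_pair_graph V l r) \<and> v \<in> pverts (interval_pair_graph V l r) \<and>
       u \<noteq> v \<and> {l u..r u} \<inter> {l v..r v} \<noteq> {}}"
    using assms overlap_iff_Int_nonempty[of l _ r]
    by (auto simp: interval_pair_graph_def simp del: Int_atLeastAtMost)
qed

lemma interval_graphE:
  assumes "interval_graph G"
  obtains l r where "\<And>v. v \<in> pverts G \<Longrightarrow> l v \<le> r v"
    and "\<And>u v. (u, v) \<in> parcs G \<longleftrightarrow> u \<in> pverts G \<and> v \<in> pverts G \<and> u \<noteq> v \<and> overlap l r u v"
proof -
  obtain l r :: "'a \<Rightarrow> real" where le: "\<forall>v \<in> pverts G. l v \<le> r v"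
    and arcs: "parcs G = {(u, v). u \<in> pverts G \<and> v \<in> pverts G \<and> u \<noteq> v \<and>
                           {l u..r u} \<inter> {l v..r v} \<noteq> {}}"
    using assms unfolding interval_graph_def by blast
  show ?thesis
  proof (rule that)
    show "l v \<le> r v" if "v \<in> pverts G" for v using le that by simp
    show "(u, v) \<in> parcs G \<longleftrightarrow> u \<in> pverts G \<and> v \<in> pverts G \<and> u \<noteq> v \<and> overlap l r u v" for u v
      using le overlap_iff_Int_nonempty[of l u r v] unfolding arcs by blast
  qed
qed

section \<open>The ring graphs\<close>

definition ring_adj :: "nat \<times> bool \<Rightarrow> nat \<times> bool \<Rightarrow> bool" where
  "ring_adj p q \<longleftrightarrow> fst p = fst q + 1 \<or> fst q = fst p + 1 \<or>
     snd p = snd q \<and> (fst p = fst q + 2 \<or> fst q = fst p + 2)"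

text \<open>Numbers the vertices pair by pair, so that the numbers themselves serve as labels for
  the bandwidth.\<close>

definition ring_code :: "nat \<times> bool \<Rightarrow> nat" where
  "ring_code p = 2 * fst p + of_bool (snd p)"

definition ring_decode :: "nat \<Rightarrow> nat \<times> bool" where
  "ring_decode v = (v div 2, odd v)"

definition ring_graph :: "nat \<Rightarrow> nat pair_pre_digraph" where
  "ring_graph n = \<lparr>pverts = {..<2 * n},
     parcs = {(u, v). u < 2 * n \<and> v < 2 * n \<and> ring_adj (ring_decode u) (ring_decode v)}\<rparr>"

lemma ring_decode_code [simp]: "ring_decode (ring_code p) = p"
  by (cases p) (auto simp: ring_decode_def ring_code_def)

lemma ring_code_decode [simp]: "ring_code (ring_decode v) = v"
  by (auto simp: ring_decode_def ring_code_def of_bool_def elim: oddE)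

lemma ring_code_inj: "ring_code p = ring_code q \<longleftrightarrow> p = q"
  by (metis ring_decode_code)

lemma ring_code_less: "ring_code p < 2 * n \<longleftrightarrow> fst p < n"
  by (auto simp: ring_code_def of_bool_def)

lemma ring_adj_irrefl: "\<not> ring_adj p p"
  by (auto simp: ring_adj_def)

lemma ring_adj_sym: "ring_adj p q \<Longrightarrow> ring_adj q p"
  by (auto simp: ring_adj_def)

lemma pair_graph_ring_graph: "pair_graph (ring_graph n)"
  by (rule pair_graphI) (auto simp: ring_graph_def ring_adj_irrefl intro: ring_adj_sym)

text \<open>Labels differ by at most 3 between consecutive pairs, and by 4 between
  \<open>(i, s)\<close> and \<open>(i + 2, s)\<close>.\<close>

lemma bandwidth_ring_graph: "bandwidth (ring_graph n) \<le> 4"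
  unfolding bandwidth_def
proof (rule Least_le, intro exI conjI)
  show "inj_on int (pverts (ring_graph n))" by simp
  have "\<bar>int (ring_code p) - int (ring_code q)\<bar> \<le> 4" if "ring_adj p q" for p q
    using that by (auto simp: ring_adj_def ring_code_def of_bool_def)
  from this[of "ring_decode _" "ring_decode _"]
  show "\<forall>(u, v)\<in>parcs (ring_graph n). \<bar>int u - int v\<bar> \<le> int 4"
    by (auto simp: ring_graph_def)
qed

text \<open>
  The side \<open>(i, s)\<close> of the concentric drawing. The parity of \<open>i\<close> determines the direction in which
  the two sides of the pair are separated, and sides extend just far enough to reach the next pair.
\<close>

definition ring_lo :: "bool \<Rightarrow> nat \<times> bool \<Rightarrow> real" where
  "ring_lo d p = (if d = even (fst p) then if snd p then real (fst p) + 1 else - real (fst p) - 3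
     else - real (fst p) - 2)"

definition ring_hi :: "bool \<Rightarrow> nat \<times> bool \<Rightarrow> real" where
  "ring_hi d p = (if d = even (fst p) then if snd p then real (fst p) + 3 else - real (fst p) - 1
     else real (fst p) + 2)"

lemma ring_lo_le_hi: "ring_lo d p \<le> ring_hi d p"
  by (auto simp: ring_lo_def ring_hi_def)

text \<open>For equal parities one direction always meets, and the other compares sides of length 2,
  which meet iff they lie on the same side and the indices differ by at most 2. For different
  parities the two directions give \<open>i \<le> j + 1\<close> and
  \<open>j \<le> i + 1\<close>.\<close>

lemma ring_adj_iff_overlap:
  assumes "p \<noteq> q"
  shows "ring_adj p q \<longleftrightarrow> (\<forall>d. overlap (ring_lo d) (ring_hi d) p q)"
proof -
  obtain i s j t where pq: "p = (i, s)" "q = (j, t)" by (metis surj_pair)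
  show ?thesis
  proof (cases "even i = even j")
    case True
    then have "i \<noteq> j + 1" "j \<noteq> i + 1" "i \<noteq> j + 3" "j \<noteq> i + 3" by auto
    moreover have "i < j + 2 \<longleftrightarrow> i < j + 1" "j < i + 2 \<longleftrightarrow> j < i + 1" using True by presburger+
    ultimately show ?thesis
      using True assms
      by (auto simp: pq ring_adj_def overlap_def ring_lo_def ring_hi_def all_bool_eq)
  next
    case False
    then have "i \<noteq> j" "i \<noteq> j + 2" "j \<noteq> i + 2" by auto
    then show ?thesis
      using False
      by (auto simp: pq ring_adj_def overlap_def ring_lo_def ring_hi_def all_bool_eq)
  qed
qed

lemma boxicity_ring_graph:
  assumes "n \<ge> 2"
  shows "boxicity (ring_graph n) = 2"
  unfolding boxicity_def
proof (rule Least_equality)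
  define I where "I k = interval_pair_graph {..<2 * n} (ring_lo (k = 0) \<circ> ring_decode)
    (ring_hi (k = 0) \<circ> ring_decode)" for k :: nat
  have adj: "ring_adj (ring_decode u) (ring_decode v) \<longleftrightarrow>
      (\<forall>d. overlap (ring_lo d) (ring_hi d) (ring_decode u) (ring_decode v))" if "u \<noteq> v" for u v
    using that by (intro ring_adj_iff_overlap) (metis ring_code_decode)
  show "boxicity_at_most (ring_graph n) 2"
    unfolding boxicity_at_most_def
  proof (intro exI[of _ I] conjI allI impI)
    show "interval_graph (I k)" for k
      unfolding I_def by (rule interval_graph_interval_pair_graph) (auto simp: ring_lo_le_hi)
    show "pverts (I k) = pverts (ring_graph n)" for k
      by (simp add: I_def interval_pair_graph_def ring_graph_def)
    show "parcs (ring_graph n) = {(u, v). u \<in> pverts (ring_graph n) \<and> v \<in> pverts (ring_graph n) \<and>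
        u \<noteq> v \<and> (\<forall>i<2. (u, v) \<in> parcs (I i))}"
    proof -
      have "(u, v) \<in> parcs (ring_graph n) \<longleftrightarrow>
          u < 2 * n \<and> v < 2 * n \<and> u \<noteq> v \<and> (\<forall>i<2. (u, v) \<in> parcs (I i))" for u v
      proof (cases "u = v")
        case False
        then show ?thesis
          using adj[OF False]
          by (auto simp: I_def interval_pair_graph_def ring_graph_def numeral_2_eq_2
              less_Suc_eq all_conj_distrib all_bool_eq overlap_def)
      qed (simp add: ring_graph_def ring_adj_irrefl)
      then show ?thesis by (auto simp: ring_graph_def)
    qed
  qed
next
  fix d assume d: "boxicity_at_most (ring_graph n) d"
  obtain I :: "nat \<Rightarrow> nat pair_pre_digraph"
    where I: "\<And>i. i < d \<Longrightarrow> interval_graph (I i)" "\<And>i. i < d \<Longrightarrow> pverts (I i) = {..<2 * n}"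
    and arcs: "\<And>u v. (u, v) \<in> parcs (ring_graph n) \<longleftrightarrow>
        u < 2 * n \<and> v < 2 * n \<and> u \<noteq> v \<and> (\<forall>i<d. (u, v) \<in> parcs (I i))"
  proof -
    obtain I :: "nat \<Rightarrow> nat pair_pre_digraph"
      where "\<forall>i<d. interval_graph (I i) \<and> pverts (I i) = pverts (ring_graph n)"
      and "parcs (ring_graph n) = {(u, v). u \<in> pverts (ring_graph n) \<and>
        v \<in> pverts (ring_graph n) \<and> u \<noteq> v \<and> (\<forall>i<d. (u, v) \<in> parcs (I i))}"
      using d unfolding boxicity_at_most_def by blast
    moreover have "pverts (ring_graph n) = {..<2 * n}" by (simp add: ring_graph_def)
    ultimately show thesis using that[of I] by simp
  qed
  show "2 \<le> d"
  proof (rule ccontr)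
    assume "\<not> 2 \<le> d"
    then have "d = 0 \<or> d = 1" by auto
    \<comment> \<open>The first two pairs, \<open>{0, 1}\<close> and \<open>{2, 3}\<close>, induce a
      4-cycle, which excludes a single interval graph.\<close>
    have edges: "(0, 2) \<in> parcs (ring_graph n)" "(0, 3) \<in> parcs (ring_graph n)"
      "(1, 2) \<in> parcs (ring_graph n)" "(1, 3) \<in> parcs (ring_graph n)"
      and nonedges: "(0, 1) \<notin> parcs (ring_graph n)" "(2, 3) \<notin> parcs (ring_graph n)"
      using assms by (auto simp: ring_graph_def ring_adj_def ring_decode_def)
    \<comment> \<open>With no interval graphs the intersection would be complete.\<close>
    have "d \<noteq> 0" using nonedges(1) arcs[of 0 1] assms by auto
    with \<open>d = 0 \<or> d = 1\<close> have "d = 1" by simp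
    obtain l r where lr: "\<And>u v. (u, v) \<in> parcs (I 0) \<longleftrightarrow>
        u \<in> pverts (I 0) \<and> v \<in> pverts (I 0) \<and> u \<noteq> v \<and> overlap l r u v"
      by (rule interval_graphE[OF I(1)[of 0]]) (use \<open>d = 1\<close> in auto)
    have "(u, v) \<in> parcs (ring_graph n) \<longleftrightarrow> u < 2 * n \<and> v < 2 * n \<and> u \<noteq> v \<and> overlap l r u v"
      for u v
      using arcs lr I(2) \<open>d = 1\<close> by auto
    then show False
      using edges nonedges overlap_diagonal[of l r 0 2 3 1] assms by auto
  qed
qed

section \<open>Box representations of the ring graphs\<close>

text \<open>The Boolean argument \<open>d\<close> of \<open>l\<close> and \<open>r\<close> selects one of the two coordinate directions.\<close>

locale ring_boxes =
  fixes n :: nat and l r :: "bool \<Rightarrow> nat \<times> bool \<Rightarrow> real"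
  assumes le: "\<And>d p. fst p < n \<Longrightarrow> l d p \<le> r d p"
    and adj_iff: "\<And>p q. fst p < n \<Longrightarrow> fst q < n \<Longrightarrow> p \<noteq> q \<Longrightarrow>
      ring_adj p q \<longleftrightarrow> (\<forall>d. overlap (l d) (r d) p q)"
    and base: "\<not> overlap (l True) (r True) (0, False) (0, True)"
begin

section \<open>Directions in which nonadjacent boxes are separated, and the gaps they leave\<close>

abbreviation meets :: "bool \<Rightarrow> nat \<times> bool \<Rightarrow> nat \<times> bool \<Rightarrow> bool" where
  "meets d \<equiv> overlap (l d) (r d)"

lemma adj_meets:
  assumes "ring_adj p q" "fst p < n" "fst q < n"
  shows "meets d p q"
  using assms adj_iff ring_adj_irrefl by blast

lemma nonadj_meets:
  assumes "\<not> ring_adj p q" "fst p < n" "fst q < n" "p \<noteq> q" "meets (\<not> d) p q"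
  shows "\<not> meets d p q"
proof
  assume "meets d p q"
  then have "\<forall>e. meets e p q" using assms(5) by (cases d) (auto simp: all_bool_eq)
  then show False using assms adj_iff by blast
qed

lemma meets_consecutive:
  assumes "Suc i < n"
  shows "meets d (i, s) (Suc i, t)"
  using assms by (intro adj_meets) (auto simp: ring_adj_def)

text \<open>Consecutive pairs are the diagonals of an induced 4-cycle, and one direction cannot
  separate both. So the direction alternates, starting from \<open>base\<close>.\<close>

lemma pair_separated:
  assumes "i < n"
  shows "\<not> meets (even i) (i, False) (i, True)"
  using assms
proof (induction i)
  case 0
  then show ?case using base by simp
next
  case (Suc i)
  then have "\<not> meets (even i) (i, False) (i, True)" by simp
  then have "meets (even i) (Suc i, False) (Suc i, True)"
    using overlap_diagonal[of "l (even i)" "r (even i)" "(i, False)" "(Suc i, False)"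
        "(Suc i, True)" "(i, True)"] meets_consecutive Suc.prems by blast
  then show ?case
    using Suc.prems by (intro nonadj_meets) (auto simp: ring_adj_def)
qed

text \<open>Here the diagonals of the induced 4-cycle are the pair \<open>Suc i\<close>, separated
  in direction \<open>odd i\<close>, and the two vertices in question, which must therefore use the
  other direction.\<close>

lemma cross_separated:
  assumes "i + 2 < n"
  shows "\<not> meets (even i) (i, s) (i + 2, \<not> s)"
proof -
  let ?d = "odd i"
  have sep: "\<not> meets ?d (Suc i, False) (Suc i, True)"
    using pair_separated[of "Suc i"] assms by simp
  have m: "meets ?d (i, s) (Suc i, t)" "meets ?d (i + 2, \<not> s) (Suc i, t)" for t
    using meets_consecutive[of i ?d] meets_consecutive[of "Suc i" ?d] assms
    by (auto simp: overlap_sym[of _ _ "(Suc (Suc i), _)"])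
  have "meets ?d (i, s) (i + 2, \<not> s)"
    using overlap_diagonal[OF m(1) m(1) m(2) m(2)] sep by blast
  then show ?thesis
    using assms by (intro nonadj_meets) (auto simp: ring_adj_def)
qed

lemma parallel_meets:
  assumes "i + 2 < n"
  shows "meets d (i, s) (i + 2, s)"
  using assms by (intro adj_meets) (auto simp: ring_adj_def)

text \<open>The two ends of the gap between the members of the \<open>i\<close>-th pair.\<close>

definition gl :: "nat \<Rightarrow> real" where
  "gl i = min (r (even i) (i, False)) (r (even i) (i, True))"

definition gr :: "nat \<Rightarrow> real" where
  "gr i = max (l (even i) (i, False)) (l (even i) (i, True))"

lemma gap_spanned:
  assumes "Suc i < n"
  shows "l (even i) (Suc i, t) \<le> gl i" "gr i \<le> r (even i) (Suc i, t)"
  using meets_consecutive[OF assms, of "even i" False t]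
    meets_consecutive[OF assms, of "even i" True t]
  by (auto simp: gl_def gr_def overlap_def)

text \<open>The smaller right end belongs to the left member and the larger left end to the right
  one; \<open>min\<close> and \<open>max\<close> avoid fixing which member is on the left.\<close>

lemma gl_less_gr:
  assumes "i < n"
  shows "gl i < gr i"
  using pair_separated[OF assms] le[of "(i, False)" "even i"] le[of "(i, True)" "even i"] assms
  by (auto simp: gl_def gr_def overlap_def)

lemma gap_step:
  assumes n: "i + 3 < n" and out: "gl (i + 2) < gl i \<or> gr i < gr (i + 2)"
  shows "gl (i + 3) < gl (i + 1) \<and> gr (i + 1) < gr (i + 3)"
proof -
  let ?d = "even i"
  \<comment> \<open>Each \<open>(i + 2, s)\<close> meets \<open>(i, s)\<close> and misses the other
    member, so both pairs have the same left-to-right order. Where the gap \<open>i + 2\<close>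
    sticks out of the gap \<open>i\<close>, the member of the pair \<open>i\<close> on that side
    contains the protruding end.\<close>
  have "\<exists>s. l ?d (i, s) \<le> gr (i + 2) \<and> gl (i + 2) \<le> r ?d (i, s)"
    using out pair_separated[of i] pair_separated[of "i + 2"] cross_separated[of i False]
      cross_separated[of i True] parallel_meets[of i ?d False] parallel_meets[of i ?d True]
      le[of "(i, False)" ?d] le[of "(i, True)" ?d] le[of "(i + 2, False)" ?d]
      le[of "(i + 2, True)" ?d] n
    by (auto simp: gl_def gr_def overlap_def ex_bool_eq min_def max_def split: if_splits)
  then obtain s where s: "l ?d (i, s) \<le> gr (i + 2)" "gl (i + 2) \<le> r ?d (i, s)" by blast
  have far: "\<not> meets (\<not> ?d) (i, s) (i + 3, t)" for t
  proof (rule nonadj_meets)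
    have "l ?d (i + 3, t) \<le> gl (i + 2)" "gr (i + 2) \<le> r ?d (i + 3, t)"
      using gap_spanned[of "i + 2" t] n by (auto simp: numeral_3_eq_3)
    then show "meets (\<not> \<not> ?d) (i, s) (i + 3, t)"
      using s by (auto simp: overlap_def)
  qed (use n in \<open>auto simp: ring_adj_def\<close>)
  have near: "meets (\<not> ?d) (i, s) (i + 1, t)" for t
    using meets_consecutive[of i "\<not> ?d" s t] n by simp
  have par: "meets (\<not> ?d) (i + 1, t) (i + 3, t)" for t
    using parallel_meets[of "i + 1" "\<not> ?d" t] n by (simp add: numeral_eq_Suc)
  have gaps: "gl (i + 1) = min (r (\<not> ?d) (i + 1, t)) (r (\<not> ?d) (i + 1, \<not> t))"
    "gr (i + 1) = max (l (\<not> ?d) (i + 1, t)) (l (\<not> ?d) (i + 1, \<not> t))"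
    "gl (i + 3) = min (r (\<not> ?d) (i + 3, t)) (r (\<not> ?d) (i + 3, \<not> t))"
    "gr (i + 3) = max (l (\<not> ?d) (i + 3, t)) (l (\<not> ?d) (i + 3, \<not> t))" for t
    by (cases t; simp add: gl_def gr_def min.commute max.commute)+
  have "\<not> meets (\<not> ?d) (i + 1, False) (i + 1, True)"
    using pair_separated[of "i + 1"] n by simp
  \<comment> \<open>\<open>(i + 1, t)\<close> is the left member of its pair. In
    \<open>overlap_strictly_between\<close>, \<open>(i, s)\<close> acts as \<open>x\<close>, the
    pair \<open>i + 1\<close> as \<open>a\<close>, \<open>a'\<close> and the pair
    \<open>i + 3\<close> as \<open>b\<close>, \<open>b'\<close>.\<close>
  then obtain t where "r (\<not> ?d) (i + 1, t) < l (\<not> ?d) (i + 1, \<not> t)"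
    unfolding overlap_def by (metis (full_types) not_le)
  then show ?thesis
    unfolding gaps[of t] by (rule overlap_strictly_between[OF near near far far par par])
qed

text \<open>The conclusion of \<open>gap_step\<close> implies its hypothesis at the next index, so
  one failure of nesting propagates to all later indices of either parity.\<close>

lemma gap_step_iterated:
  assumes "gl (i + 2) < gl i \<or> gr i < gr (i + 2)" "i < j" "j + 2 < n"
  shows "gl (j + 2) < gl j \<and> gr j < gr (j + 2)"
  using assms(2,3)
proof (induction j)
  case (Suc j)
  have "gl (j + 2) < gl j \<or> gr j < gr (j + 2)"
    using Suc assms(1) by (cases "i = j") auto
  then show ?case
    using gap_step[of j] Suc.prems by (simp add: numeral_eq_Suc)
qed simp

lemma gap_nested:
  assumes "\<And>j. j < k \<Longrightarrow> gl (i + 2 * (j + 1)) \<le> gl (i + 2 * j) \<and> gr (i + 2 * j) \<le> gr (i + 2 * (j + 1))"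
  shows "gl (i + 2 * k) \<le> gl i \<and> gr i \<le> gr (i + 2 * k)"
  using assms by (induction k) fastforce+

text \<open>Both members of each pair \<open>i + 2 * j + 1\<close> span the gap
  \<open>i + 2 * j\<close> and hence contain \<open>x\<close>. The indices of these gaps share a
  parity, so all of this happens in one direction.\<close>

lemma spanning_family:
  assumes "i + 2 * m + 1 < n"
    and point: "\<And>j. j \<le> m \<Longrightarrow> gl (i + 2 * j) \<le> x \<and> x \<le> gr (i + 2 * j)"
  shows "\<exists>d S. S \<subseteq> {..<n} \<times> UNIV \<and> card S = 2 * (m + 1) \<and> (\<forall>p\<in>S. \<forall>q\<in>S. meets d p q)"
proof (intro exI conjI)
  let ?S = "(\<lambda>j. i + 2 * j + 1) ` {..m} \<times> (UNIV :: bool set)"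
  show "?S \<subseteq> {..<n} \<times> UNIV" using assms(1) by auto
  have "card ((\<lambda>j. i + 2 * j + 1) ` {..m}) = m + 1"
    by (subst card_image) (auto simp: inj_on_def)
  then show "card ?S = 2 * (m + 1)" by (simp add: card_cartesian_product)
  have "l (even i) p \<le> x \<and> x \<le> r (even i) p" if p_in: "p \<in> ?S" for p
  proof -
    obtain j t where p: "p = (Suc (i + 2 * j), t)" "j \<le> m"
      using p_in by (cases p) auto
    show ?thesis
      using gap_spanned[of "i + 2 * j" t] point[OF p(2)] assms(1) p by auto
  qed
  then show "\<forall>p\<in>?S. \<forall>q\<in>?S. meets (even i) p q"
    unfolding overlap_def by (meson order_trans)
qed

lemma large_meeting_family:
  assumes n: "n = 4 * m + 4"
  shows "\<exists>d S. S \<subseteq> {..<n} \<times> UNIV \<and> card S = 2 * (m + 1) \<and> (\<forall>p\<in>S. \<forall>q\<in>S. meets d p q)"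
proof (cases "\<exists>i\<le>2 * m. gl (i + 2) < gl i \<or> gr i < gr (i + 2)")
  case True
  then obtain i where i: "i \<le> 2 * m" "gl (i + 2) < gl i \<or> gr i < gr (i + 2)" by blast
  \<comment> \<open>\<open>?b\<close> exceeds \<open>i\<close>, so gaps grow from there on and the
    gap \<open>?b\<close> is the innermost; the last pair used has index
    \<open>4 * m + 2 < n\<close>.\<close>
  let ?b = "2 * m + 1"
  have step: "gl (?b + 2 * (j + 1)) \<le> gl (?b + 2 * j) \<and> gr (?b + 2 * j) \<le> gr (?b + 2 * (j + 1))"
    if "j < m" for j
    using gap_step_iterated[OF i(2), of "?b + 2 * j"] i(1) that n by (simp add: algebra_simps)
  have nest: "gl (?b + 2 * j) \<le> gl ?b \<and> gr ?b \<le> gr (?b + 2 * j)" if "j \<le> m" for j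
    by (rule gap_nested) (use step that in simp)
  show ?thesis
  proof (rule spanning_family)
    show "?b + 2 * m + 1 < n" using n by simp
    show "gl (?b + 2 * j) \<le> gl ?b \<and> gl ?b \<le> gr (?b + 2 * j)" if "j \<le> m" for j
      using nest[OF that] gl_less_gr[of ?b] n by linarith
  qed
next
  case False
  \<comment> \<open>Without a failure the even gaps shrink up to \<open>2 * m\<close>, so the
    innermost gap is now the last one.\<close>
  have nest: "gl (2 * j) \<le> gl (2 * m) \<and> gr (2 * m) \<le> gr (2 * j)" if "j \<le> m" for j
    using that
  proof (induction rule: inc_induct)
    case (step j)
    then have "\<not> (gl (2 * j + 2) < gl (2 * j) \<or> gr (2 * j) < gr (2 * j + 2))"
      using False by simp
    with step.IH show ?case by simp
  qed simp
  show ?thesis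
  proof (rule spanning_family[of 0 m "gl (2 * m)"])
    show "0 + 2 * m + 1 < n" using n by simp
    show "gl (0 + 2 * j) \<le> gl (2 * m) \<and> gl (2 * m) \<le> gr (0 + 2 * j)" if "j \<le> m" for j
      using nest[OF that] gl_less_gr[of "2 * m"] n by simp
  qed
qed

end

section \<open>From box representations back to treewidth\<close>

lemma ring_graph_treewidth:
  assumes n: "n = 4 * m + 4"
    and I: "interval_graph I1" "interval_graph I2"
    and verts: "pverts I1 = pverts (ring_graph n)" "pverts I2 = pverts (ring_graph n)"
    and arcs: "parcs (ring_graph n) = parcs I1 \<inter> parcs I2"
  shows "2 * int m + 1 \<le> treewidth I1 \<or> 2 * int m + 1 \<le> treewidth I2"
proof -
  define J where "J d = (if d then I1 else I2)" for d
  have J: "interval_graph (J d)" "pverts (J d) = {..<2 * n}" for d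
    using I verts by (auto simp: J_def ring_graph_def)
  have "\<exists>l r. (\<forall>v<2 * n. l v \<le> r v) \<and> (\<forall>u v. (u, v) \<in> parcs (J d) \<longleftrightarrow>
      u < 2 * n \<and> v < 2 * n \<and> u \<noteq> v \<and> overlap l r u v)" for d
    by (rule interval_graphE[OF J(1)[of d]]) (metis J(2) lessThan_iff)
  then obtain l r where lr: "\<And>d v. v < 2 * n \<Longrightarrow> l d v \<le> r d v"
    "\<And>d u v. (u, v) \<in> parcs (J d) \<longleftrightarrow>
      u < 2 * n \<and> v < 2 * n \<and> u \<noteq> v \<and> overlap (l d) (r d) u v"
    by metis
  have adj: "ring_adj p q \<longleftrightarrow> (\<forall>d. overlap (l d) (r d) (ring_code p) (ring_code q))"
    if "fst p < n" "fst q < n" "p \<noteq> q" for p q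
  proof -
    have "ring_adj p q \<longleftrightarrow> (ring_code p, ring_code q) \<in> parcs (ring_graph n)"
      using that by (simp add: ring_graph_def ring_code_less)
    also have "\<dots> \<longleftrightarrow> (\<forall>d. (ring_code p, ring_code q) \<in> parcs (J d))"
      using arcs by (auto simp: J_def)
    finally show ?thesis using that by (simp add: lr(2) ring_code_less ring_code_inj)
  qed
  have "\<not> ring_adj (0, False) (0, True)" by (simp add: ring_adj_def)
  \<comment> \<open>One of the two graphs separates the initial pair. Reindexing by
    \<open>d = e\<close> makes it direction \<open>True\<close>, as \<open>base\<close>
    demands.\<close>
  then obtain e where e: "\<not> overlap (l e) (r e) (ring_code (0, False)) (ring_code (0, True))"
    using adj[of "(0, False)" "(0, True)"] n by auto
  interpret ring_boxes n "\<lambda>d p. l (d = e) (ring_code p)" "\<lambda>d p. r (d = e) (ring_code p)"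
  proof
    show "ring_adj p q \<longleftrightarrow>
        (\<forall>d. overlap (\<lambda>p. l (d = e) (ring_code p)) (\<lambda>p. r (d = e) (ring_code p)) p q)"
      if "fst p < n" "fst q < n" "p \<noteq> q" for p q
      using adj[OF that] by (cases e) (auto simp: overlap_def all_bool_eq)
    show "\<not> overlap (\<lambda>p. l (True = e) (ring_code p)) (\<lambda>p. r (True = e) (ring_code p))
        (0, False) (0, True)"
      using e by (cases e) (auto simp: overlap_def)
  qed (simp add: lr(1) ring_code_less)
  obtain d S where S: "S \<subseteq> {..<n} \<times> UNIV" "card S = 2 * (m + 1)"
    and meets: "\<And>p q. p \<in> S \<Longrightarrow> q \<in> S \<Longrightarrow> meets d p q"
    using large_meeting_family[OF n] by blast
  \<comment> \<open>Pairwise overlap in one direction is a clique in the corresponding interval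
    graph, here with \<open>2 * m + 2\<close> vertices.\<close>
  have "clique (J (d = e)) (ring_code ` S)"
    unfolding clique_def
  proof (intro conjI ballI impI)
    show "ring_code ` S \<subseteq> pverts (J (d = e))"
      using S(1) by (auto simp: J(2) ring_code_less)
    fix u v assume "u \<in> ring_code ` S" "v \<in> ring_code ` S" "u \<noteq> v"
    then show "(u, v) \<in> parcs (J (d = e))"
      using S(1) meets by (auto simp: lr(2) ring_code_less overlap_def)
  qed
  moreover have "card (ring_code ` S) = 2 * (m + 1)"
    using S(2) by (subst card_image) (auto simp: inj_on_def ring_code_inj)
  moreover have "pair_graph (J (d = e))" using J(1) by (auto simp: interval_graph_def)
  ultimately have "2 * int m + 1 \<le> treewidth (J (d = e))"
    using treewidth_ge_clique by fastforce
  then show ?thesis by (auto simp: J_def split: if_splits)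
qed

theorem theorem3:
  shows "\<exists>(F :: nat pair_pre_digraph set) (k :: nat) (c :: real).
    c > 0 \<and>
    infinite ((\<lambda>G. card (pverts G)) ` F) \<and>
    (\<forall>G \<in> F. pair_graph G \<and> boxicity G = 2 \<and> bandwidth G \<le> k \<and>
       (\<forall>I1 I2. interval_graph I1 \<and> interval_graph I2 \<and>
          pverts I1 = pverts G \<and> pverts I2 = pverts G \<and>
          parcs G = parcs I1 \<inter> parcs I2 \<longrightarrow>
          c * real (card (pverts G)) \<le> real_of_int (treewidth I1) \<or>
          c * real (card (pverts G)) \<le> real_of_int (treewidth I2)))"
proof (intro exI conjI ballI)
  let ?F = "range (\<lambda>m. ring_graph (4 * m + 4))"
  have card: "card (pverts (ring_graph n)) = 2 * n" for n by (simp add: ring_graph_def)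
  \<comment> \<open>The graph has \<open>8 * m + 8\<close> vertices, and an eighth of this,
    \<open>m + 1\<close>, is at most the bound \<open>2 * m + 1\<close>.\<close>
  show "(1 / 8 :: real) > 0" by simp
  have "inj (\<lambda>m. card (pverts (ring_graph (4 * m + 4))))"
    by (auto simp: inj_def card)
  then show "infinite ((\<lambda>G. card (pverts G)) ` ?F)"
    unfolding image_image by (rule range_inj_infinite)
  fix G assume "G \<in> ?F"
  then obtain m where G: "G = ring_graph (4 * m + 4)" by auto
  show "pair_graph G" "boxicity G = 2" "bandwidth G \<le> 4"
    by (simp_all add: G pair_graph_ring_graph boxicity_ring_graph bandwidth_ring_graph)
  show "\<forall>I1 I2. interval_graph I1 \<and> interval_graph I2 \<and> pverts I1 = pverts G \<and>
      pverts I2 = pverts G \<and> parcs G = parcs I1 \<inter> parcs I2 \<longrightarrow>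
      1 / 8 * real (card (pverts G)) \<le> real_of_int (treewidth I1) \<or>
      1 / 8 * real (card (pverts G)) \<le> real_of_int (treewidth I2)"
  proof (intro allI impI, elim conjE)
    fix I1 I2 :: "nat pair_pre_digraph"
    assume "interval_graph I1" "interval_graph I2" "pverts I1 = pverts G" "pverts I2 = pverts G"
      "parcs G = parcs I1 \<inter> parcs I2"
    then have "2 * int m + 1 \<le> treewidth I1 \<or> 2 * int m + 1 \<le> treewidth I2"
      unfolding G by (intro ring_graph_treewidth) auto
    moreover have "1 / 8 * real (card (pverts G)) \<le> real_of_int (2 * int m + 1)"
      by (simp add: G card)
    ultimately show "1 / 8 * real (card (pverts G)) \<le> real_of_int (treewidth I1) \<or>
        1 / 8 * real (card (pverts G)) \<le> real_of_int (treewidth I2)"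
      by (meson of_int_le_iff order_trans)
  qed
qed

end
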